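(* Let $(f,M)$ be a polymatroid which has a non-principal modular cut. Then $(f,M)$ is not sticky.
   Context: All sets are finite. A polymatroid $(f,M)$ is a finite set $M$ with a real-valued function $f$ on subsets of $M$ (with $f(\emptyset)=0$) that is non-negative, monotone ($A\subseteq B\Rightarrow f(A)\le f(B)$) and submodular ($f(A)+f(B)\ge f(A\cap B)+f(A\cup B)$). A subset $F\subseteq M$ is a flat if every proper superset of $F$ in $M$ has strictly larger rank. The modular defect of $A,B$ is $\delta(A,B)=f(A)+f(B)-f(A\cap B)-f(A\cup B)\ge 0$; $(A,B)$ is a modular pair if $\delta(A,B)=0$. A modular cut is a collection $\mathcal M$ of flats such that (i) if $F_1\in\mathcal M$ and $F_1\subseteq F_2$ with $F_2$ a flat then $F_2\in\mathcal M$, and (ii) if $F_1,F_2\in\mathcal M$ form a modular pair then $F_1\cap F_2\in\mathcal M$. The modular cut $\mathcal M$ is principal if the intersection of all elements of $\mathcal M$ belongs to $\mathcal M$ (this includes the case $\mathcal M=\emptyset$). A polymatroid $(g,N)$ is an extension of $(f,M)$ if $N\supseteq M$ and $g(A)=f(A)$ for all $A\subseteq M$. $(f,M)$ is sticky if for any two extensions $(g_1,N_1)$, $(g_2,N_2)$ of $(f,M)$ with $N_1\cap N_2=M$ there is a polymatroid $(h,N_1\cup N_2)$ (an amalgam) which is an extension of both $(g_1,N_1)$ and $(g_2,N_2)$. *)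

theory Defs
  imports Complex_Main "HOL-Library.Infinite_Typeclass"
begin

text \<open>
  A rank function is a total function on sets; only its values on subsets of the ground set matter,
  and every notion below looks at those values only.
\<close>

definition polymatroid :: "('a set \<Rightarrow> real) \<Rightarrow> 'a set \<Rightarrow> bool" where
  "polymatroid f M \<longleftrightarrow>
     finite M \<and> f {} = 0 \<and>
     (\<forall>A. A \<subseteq> M \<longrightarrow> 0 \<le> f A) \<and>
     (\<forall>A B. A \<subseteq> B \<and> B \<subseteq> M \<longrightarrow> f A \<le> f B) \<and>
     (\<forall>A B. A \<subseteq> M \<and> B \<subseteq> M \<longrightarrow> f A + f B \<ge> f (A \<inter> B) + f (A \<union> B))"

definition flat :: "('a set \<Rightarrow> real) \<Rightarrow> 'a set \<Rightarrow> 'a set \<Rightarrow> bool" where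
  "flat f M F \<longleftrightarrow> F \<subseteq> M \<and> (\<forall>A. F \<subset> A \<and> A \<subseteq> M \<longrightarrow> f F < f A)"

definition modular_defect :: "('a set \<Rightarrow> real) \<Rightarrow> 'a set \<Rightarrow> 'a set \<Rightarrow> real" where
  "modular_defect f A B = f A + f B - f (A \<inter> B) - f (A \<union> B)"

definition modular_pair :: "('a set \<Rightarrow> real) \<Rightarrow> 'a set \<Rightarrow> 'a set \<Rightarrow> bool" where
  "modular_pair f A B \<longleftrightarrow> modular_defect f A B = 0"

definition modular_cut :: "('a set \<Rightarrow> real) \<Rightarrow> 'a set \<Rightarrow> 'a set set \<Rightarrow> bool" where
  "modular_cut f M \<M> \<longleftrightarrow>
     (\<forall>F\<in>\<M>. flat f M F) \<and>
     (\<forall>F\<^sub>1 F\<^sub>2. F\<^sub>1 \<in> \<M> \<and> F\<^sub>1 \<subseteq> F\<^sub>2 \<and> flat f M F\<^sub>2 \<longrightarrow> F\<^sub>2 \<in> \<M>) \<and>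
     (\<forall>F\<^sub>1 F\<^sub>2. F\<^sub>1 \<in> \<M> \<and> F\<^sub>2 \<in> \<M> \<and> modular_pair f F\<^sub>1 F\<^sub>2 \<longrightarrow> F\<^sub>1 \<inter> F\<^sub>2 \<in> \<M>)"

text \<open>
  The empty modular cut counts as principal by convention, although the intersection of its
  elements is not an element of it.
\<close>

definition principal_cut :: "'a set set \<Rightarrow> bool" where
  "principal_cut \<M> \<longleftrightarrow> \<M> = {} \<or> \<Inter>\<M> \<in> \<M>"

definition extension :: "('a set \<Rightarrow> real) \<Rightarrow> 'a set \<Rightarrow> ('a set \<Rightarrow> real) \<Rightarrow> 'a set \<Rightarrow> bool" where
  "extension g N f M \<longleftrightarrow> polymatroid g N \<and> M \<subseteq> N \<and> (\<forall>A. A \<subseteq> M \<longrightarrow> g A = f A)"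

definition amalgam ::
  "('a set \<Rightarrow> real) \<Rightarrow> ('a set \<Rightarrow> real) \<Rightarrow> 'a set \<Rightarrow> ('a set \<Rightarrow> real) \<Rightarrow> 'a set \<Rightarrow> bool" where
  "amalgam h g\<^sub>1 N\<^sub>1 g\<^sub>2 N\<^sub>2 \<longleftrightarrow>
     extension h (N\<^sub>1 \<union> N\<^sub>2) g\<^sub>1 N\<^sub>1 \<and> extension h (N\<^sub>1 \<union> N\<^sub>2) g\<^sub>2 N\<^sub>2"

text \<open>
  Stickiness quantifies over all (finite) extensions, whose ground sets are taken inside the type
  of the elements of \<open>M\<close>. The sort \<open>infinite\<close> makes this adequate: outside any finite set there
  are always enough new elements to carry a copy of every pair of extensions of \<open>M\<close>. Over a finite
  type the notion would degenerate, e.g. for \<open>M = UNIV\<close>, where no proper extension exists.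
\<close>

definition sticky :: "('a::infinite set \<Rightarrow> real) \<Rightarrow> 'a set \<Rightarrow> bool" where
  "sticky f M \<longleftrightarrow>
     (\<forall>g\<^sub>1 N\<^sub>1 g\<^sub>2 N\<^sub>2.
        extension g\<^sub>1 N\<^sub>1 f M \<and> extension g\<^sub>2 N\<^sub>2 f M \<and> N\<^sub>1 \<inter> N\<^sub>2 = M \<longrightarrow>
        (\<exists>h. amalgam h g\<^sub>1 N\<^sub>1 g\<^sub>2 N\<^sub>2))"

end

theory Submission
  imports Defs
begin

text \<open>
  Choose \<open>F\<^sub>1, F\<^sub>2\<close> in the cut with \<open>K = F\<^sub>1 \<inter> F\<^sub>2\<close> outside it and with least modular defect \<open>d > 0\<close>.
  Write \<open>m A\<close> for the least rank of a member of the cut containing \<open>A\<close>. For \<open>0 \<le> c \<le> d\<close> the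
  function \<open>min (f A + c) (m A)\<close> is the rank of \<open>A\<close> together with a new point of weight \<open>c\<close> that
  lies in all members of the cut. One extension of \<open>f\<close> adds such a point \<open>e\<close> of weight \<open>d\<close>. The
  other one resembles the Vamos matroid: it adds \<open>x\<close> and \<open>y\<close>, each consisting of such a point of weight \<open>\<theta>\<close>
  slightly above \<open>d / 2\<close> and of a free part, but independent of each other over \<open>K\<close>.
  In an amalgam, the conditional ranks satisfy
  \<open>h (e | K) \<le> h (e | K x) + h (e | K y) \<le> 2 (d - \<theta>) < d\<close>, contradicting \<open>h (e | K) = d\<close>.
\<close>

subsection \<open>Monotone submodular functions\<close>

text \<open>Normalisation at the empty set is dropped, so that the rank of a set together with fixed
  new points, viewed as a function of the old part, is covered too.\<close>

definition rank_like :: "('a set \<Rightarrow> real) \<Rightarrow> 'a set \<Rightarrow> bool" where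
  "rank_like a M \<longleftrightarrow>
     (\<forall>A B. A \<subseteq> B \<and> B \<subseteq> M \<longrightarrow> a A \<le> a B) \<and>
     (\<forall>A B. A \<subseteq> M \<and> B \<subseteq> M \<longrightarrow> a (A \<inter> B) + a (A \<union> B) \<le> a A + a B)"

lemma rank_likeI:
  assumes "\<And>A B. A \<subseteq> B \<Longrightarrow> B \<subseteq> M \<Longrightarrow> a A \<le> a B"
    and "\<And>A B. A \<subseteq> M \<Longrightarrow> B \<subseteq> M \<Longrightarrow> a (A \<inter> B) + a (A \<union> B) \<le> a A + a B"
  shows "rank_like a M"
  using assms unfolding rank_like_def by blast

lemma rank_like_mono: "rank_like a M \<Longrightarrow> A \<subseteq> B \<Longrightarrow> B \<subseteq> M \<Longrightarrow> a A \<le> a B"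
  unfolding rank_like_def by blast

lemma rank_like_submodular:
  "rank_like a M \<Longrightarrow> A \<subseteq> M \<Longrightarrow> B \<subseteq> M \<Longrightarrow> a (A \<inter> B) + a (A \<union> B) \<le> a A + a B"
  unfolding rank_like_def by blast

lemma rank_like_add_const:
  assumes "rank_like a M"
  shows "rank_like (\<lambda>A. a A + c) M"
proof (rule rank_likeI)
  show "a A + c \<le> a B + c" if "A \<subseteq> B" "B \<subseteq> M" for A B
    using rank_like_mono[OF assms that] by simp
  show "(a (A \<inter> B) + c) + (a (A \<union> B) + c) \<le> (a A + c) + (a B + c)"
    if "A \<subseteq> M" "B \<subseteq> M" for A B
    using rank_like_submodular[OF assms that] by simp
qed

lemma polymatroid_iff_rank_like:
  "polymatroid f M \<longleftrightarrow> finite M \<and> f {} = 0 \<and> rank_like f M"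
proof -
  have "0 \<le> f A" if "f {} = 0" "rank_like f M" "A \<subseteq> M" for A
    using rank_like_mono[OF that(2) empty_subsetI that(3)] that(1) by simp
  then show ?thesis
    unfolding polymatroid_def by (auto simp: rank_like_def)
qed

section \<open>Adjoining a single point\<close>

definition adjoin :: "'a \<Rightarrow> ('a set \<Rightarrow> real) \<Rightarrow> ('a set \<Rightarrow> real) \<Rightarrow> 'a set \<Rightarrow> real" where
  "adjoin e a b A = (if e \<in> A then b (A - {e}) else a A)"

lemma adjoin_notin [simp]: "e \<notin> A \<Longrightarrow> adjoin e a b A = a A"
  by (simp add: adjoin_def)

lemma adjoin_insert [simp]: "e \<notin> A \<Longrightarrow> adjoin e a b (insert e A) = b A"
  by (simp add: adjoin_def)

lemma subset_insert_cases:
  assumes "A \<subseteq> insert e M" "e \<notin> M"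
  obtains "A \<subseteq> M" "e \<notin> A" | A' where "A = insert e A'" "A' \<subseteq> M" "e \<notin> A'"
proof (cases "e \<in> A")
  case True
  then have "A = insert e (A - {e})" "A - {e} \<subseteq> M" "e \<notin> A - {e}"
    using assms by auto
  then show ?thesis by (rule that(2))
next
  case False
  then show ?thesis using assms that(1) by blast
qed

text \<open>The gain \<open>b - a\<close> of the new point has to be nonnegative and diminishing.
  Two sets of which exactly one contains \<open>e\<close> then satisfy submodularity by that of
  \<open>a\<close> plus the diminishing gain.\<close>

lemma rank_like_adjoin:
  assumes a: "rank_like a M" and b: "rank_like b M"
    and le: "\<And>A. A \<subseteq> M \<Longrightarrow> a A \<le> b A"
    and anti: "\<And>A B. A \<subseteq> B \<Longrightarrow> B \<subseteq> M \<Longrightarrow> b B - a B \<le> b A - a A"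
    and e: "e \<notin> M"
  shows "rank_like (adjoin e a b) (insert e M)"
proof (rule rank_likeI)
  fix A B assume AB: "A \<subseteq> B" and B: "B \<subseteq> insert e M"
  have A: "A \<subseteq> insert e M" using AB B by blast
  from A e show "adjoin e a b A \<le> adjoin e a b B"
  proof (cases rule: subset_insert_cases)
    case 1
    from B e show ?thesis
    proof (cases rule: subset_insert_cases)
      case 1
      then show ?thesis using \<open>e \<notin> A\<close> rank_like_mono[OF a AB] by simp
    next
      case (2 B')
      have "A \<subseteq> B'" using 2 AB \<open>e \<notin> A\<close> by blast
      then have "a A \<le> a B'" using rank_like_mono[OF a] 2 by simp
      then show ?thesis using le[of B'] 2 \<open>e \<notin> A\<close> by simp
    qed
  next
    case (2 A')
    from B e show ?thesis
    proof (cases rule: subset_insert_cases)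
      case 1
      then show ?thesis using 2 AB by blast
    next
      case (2 B')
      have "A' \<subseteq> B'" using \<open>A = insert e A'\<close> \<open>e \<notin> A'\<close> 2 AB by blast
      then have "b A' \<le> b B'" using rank_like_mono[OF b] 2 by simp
      then show ?thesis using \<open>A = insert e A'\<close> \<open>e \<notin> A'\<close> 2 by simp
    qed
  qed
next
  let ?h = "adjoin e a b"
  have mixed: "?h (A \<inter> insert e B) + ?h (A \<union> insert e B) \<le> ?h A + ?h (insert e B)"
    if "A \<subseteq> M" "B \<subseteq> M" for A B
  proof -
    have n: "e \<notin> A" "e \<notin> B" using that e by auto
    have eq: "A \<inter> insert e B = A \<inter> B" "A \<union> insert e B = insert e (A \<union> B)"
      using n by auto
    have "a (A \<inter> B) + a (A \<union> B) \<le> a A + a B"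
      using rank_like_submodular[OF a that] .
    moreover have "b (A \<union> B) - a (A \<union> B) \<le> b B - a B"
      using anti[of B "A \<union> B"] that by blast
    ultimately show ?thesis unfolding eq using n by simp
  qed
  fix A B assume A: "A \<subseteq> insert e M" and B: "B \<subseteq> insert e M"
  from A e show "?h (A \<inter> B) + ?h (A \<union> B) \<le> ?h A + ?h B"
  proof (cases rule: subset_insert_cases)
    case 1
    from B e show ?thesis
    proof (cases rule: subset_insert_cases)
      case 1
      then show ?thesis using \<open>e \<notin> A\<close> rank_like_submodular[OF a \<open>A \<subseteq> M\<close>] by simp
    next
      case (2 B')
      then show ?thesis using mixed[OF \<open>A \<subseteq> M\<close>] by blast
    qed
  next
    case (2 A')
    note A' = this
    from B e show ?thesis
    proof (cases rule: subset_insert_cases)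
      case 1
      then show ?thesis using mixed[of B A'] A' by (simp add: Int_commute Un_commute)
    next
      case (2 B')
      have "A \<inter> B = insert e (A' \<inter> B')" "A \<union> B = insert e (A' \<union> B')"
        using A' 2 by auto
      then show ?thesis using A' 2 rank_like_submodular[OF b, of A' B'] by simp
    qed
  qed
qed

section \<open>Flat hulls, gaps between ranks, and a concave real function\<close>

lemma polymatroid_flat_hull:
  assumes "polymatroid f M" and "A \<subseteq> M"
  obtains G where "flat f M G" "A \<subseteq> G" "f G = f A"
proof -
  have fin: "finite M" and mono: "rank_like f M"
    using assms(1) by (auto simp: polymatroid_iff_rank_like)
  let ?S = "{G. A \<subseteq> G \<and> G \<subseteq> M \<and> f G = f A}"
  have "finite ?S" "A \<in> ?S"
    using fin assms(2) by (auto intro: finite_subset[of _ "Pow M"])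
  then have "\<exists>G\<in>?S. A \<subseteq> G \<and> (\<forall>H\<in>?S. G \<subseteq> H \<longrightarrow> G = H)"
    by (rule finite_has_maximal2)
  then obtain G where G: "G \<in> ?S" and max: "\<forall>H\<in>?S. G \<subseteq> H \<longrightarrow> G = H"
    by (elim bexE conjE)
  have "f G < f B" if "G \<subset> B" "B \<subseteq> M" for B
  proof -
    have "f G \<le> f B" using rank_like_mono[OF mono, of G B] that by blast
    moreover have "f G \<noteq> f B" using max[THEN bspec, of B] that G by auto
    ultimately show ?thesis by simp
  qed
  with G that[of G] show ?thesis by (auto simp: flat_def)
qed

lemma finite_image_gap:
  fixes f :: "'b \<Rightarrow> real"
  assumes "finite S"
  obtains \<gamma> where "\<gamma> > 0" "\<And>A B. A \<in> S \<Longrightarrow> B \<in> S \<Longrightarrow> f A < f B \<Longrightarrow> f A + \<gamma> \<le> f B"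
proof -
  \<comment> \<open>The extra \<open>1\<close> is the default gap when \<open>f\<close> is constant
    on \<open>S\<close>.\<close>
  let ?D = "insert 1 ((\<lambda>(A, B). f B - f A) ` {(A, B) \<in> S \<times> S. f A < f B})"
  have fin: "finite ?D" using assms by (auto intro: finite_subset[of _ "S \<times> S"])
  have "Min ?D \<in> ?D" by (rule Min_in[OF fin]) simp
  then have "Min ?D > 0" by auto
  moreover have "f A + Min ?D \<le> f B" if "A \<in> S" "B \<in> S" "f A < f B" for A B
  proof -
    have "f B - f A \<in> ?D" using that by auto
    then have "Min ?D \<le> f B - f A" using Min_le[OF fin] by blast
    then show ?thesis by simp
  qed
  ultimately show ?thesis by (rule that)
qed

text \<open>The function \<open>t - k * exp (c * t)\<close> is concave and, by \<open>small\<close>,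
  nondecreasing up to \<open>w\<close>. Concavity handles \<open>x\<close> and
  \<open>z + w - x\<close>, which have the same sum as \<open>z\<close> and \<open>w\<close>;
  monotonicity then replaces \<open>z + w - x\<close> by \<open>y\<close>.\<close>

lemma exp_exchange:
  fixes w x y z c k :: real
  assumes zx: "z \<le> x" and xw: "x \<le> w" and yw: "y \<le> w" and sub: "z + w \<le> x + y"
    and "0 \<le> c" "0 \<le> k" and small: "k * c * exp (c * w) \<le> 1"
  shows "(z - k * exp (c * z)) + (w - k * exp (c * w)) \<le> (x - k * exp (c * x)) + (y - k * exp (c * y))"
proof -
  let ?q = "z + w - x"
  have lip: "k * exp (c * y) - k * exp (c * ?q) \<le> y - ?q"
  proof -
    have "exp (c * ?q) = exp (c * y) * exp (c * (?q - y))"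
      by (simp add: exp_add[symmetric] algebra_simps)
    also have "\<dots> \<ge> exp (c * y) * (1 + c * (?q - y))"
      by (intro mult_left_mono exp_ge_add_one_self) simp
    finally have "exp (c * y) - exp (c * ?q) \<le> c * exp (c * y) * (y - ?q)"
      by (simp add: algebra_simps)
    also have "\<dots> \<le> c * exp (c * w) * (y - ?q)"
      using \<open>0 \<le> c\<close> yw sub by (intro mult_right_mono mult_left_mono) (auto intro: mult_left_mono)
    finally have "k * (exp (c * y) - exp (c * ?q)) \<le> k * (c * exp (c * w) * (y - ?q))"
      using \<open>0 \<le> k\<close> by (rule mult_left_mono)
    also have "\<dots> = (k * c * exp (c * w)) * (y - ?q)" by simp
    also have "\<dots> \<le> 1 * (y - ?q)"
      using small sub by (intro mult_right_mono) auto
    finally show ?thesis by (simp add: algebra_simps)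
  qed
  \<comment> \<open>Convexity of \<open>exp\<close> for two pairs of equal sum, in factored
    form.\<close>
  have "0 \<le> (exp (c * w) - exp (c * x)) * (1 - exp (c * (z - x)))"
    using \<open>0 \<le> c\<close> zx xw by (intro mult_nonneg_nonneg) (auto intro: mult_left_mono simp: mult_nonneg_nonpos)
  also have "\<dots> = exp (c * w) + exp (c * z) - exp (c * x) - exp (c * ?q)"
    by (simp add: algebra_simps exp_add[symmetric])
  finally have "0 \<le> k * (exp (c * w) + exp (c * z) - exp (c * x) - exp (c * ?q))"
    using \<open>0 \<le> k\<close> by simp
  with lip show ?thesis by (simp add: algebra_simps)
qed

subsection \<open>Pairs of least defect in a non-principal cut\<close>

locale critical_pair =
  fixes f :: "'a set \<Rightarrow> real" and M :: "'a set" and \<M> :: "'a set set" and F\<^sub>1 F\<^sub>2 :: "'a set"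
  assumes polymatroid: "polymatroid f M"
    and cut: "modular_cut f M \<M>"
    and F\<^sub>1: "F\<^sub>1 \<in> \<M>" and F\<^sub>2: "F\<^sub>2 \<in> \<M>" and Int_notin: "F\<^sub>1 \<inter> F\<^sub>2 \<notin> \<M>"
    and minimal: "\<And>G H. G \<in> \<M> \<Longrightarrow> H \<in> \<M> \<Longrightarrow> G \<inter> H \<notin> \<M> \<Longrightarrow>
      modular_defect f F\<^sub>1 F\<^sub>2 \<le> modular_defect f G H"
begin

definition d :: real where "d = modular_defect f F\<^sub>1 F\<^sub>2"

definition m :: "'a set \<Rightarrow> real" where "m A = Min (f ` {G \<in> \<M>. A \<subseteq> G})"

lemma rank_like: "rank_like f M" and finite_M: "finite M" and f_empty: "f {} = 0"
  using polymatroid by (auto simp: polymatroid_iff_rank_like)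

lemmas mono = rank_like_mono[OF rank_like]
lemmas submodular = rank_like_submodular[OF rank_like]

lemma f_nonneg: "A \<subseteq> M \<Longrightarrow> 0 \<le> f A"
  using polymatroid by (simp add: polymatroid_def)

lemma cut_flat: "G \<in> \<M> \<Longrightarrow> flat f M G"
  using cut unfolding modular_cut_def by blast

lemma cut_subset: "G \<in> \<M> \<Longrightarrow> G \<subseteq> M"
  using cut_flat by (simp add: flat_def)

lemma cut_hull:
  assumes "G \<in> \<M>" "G \<subseteq> A" "A \<subseteq> M"
  obtains H where "H \<in> \<M>" "A \<subseteq> H" "f H = f A"
proof -
  obtain H where "flat f M H" "A \<subseteq> H" "f H = f A"
    using polymatroid_flat_hull[OF polymatroid assms(3)] .
  moreover from this have "H \<in> \<M>"
    using cut assms unfolding modular_cut_def by blast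
  ultimately show ?thesis using that by blast
qed

lemma finite_cut: "finite \<M>"
  using finite_M cut_subset by (auto intro: finite_subset[of _ "Pow M"])

text \<open>Makes the family minimised in \<open>m A\<close> nonempty for every
  \<open>A \<subseteq> M\<close>.\<close>

lemma M_in_cut: "M \<in> \<M>"
proof -
  obtain H where "H \<in> \<M>" "M \<subseteq> H"
    by (rule cut_hull[OF F\<^sub>1 cut_subset[OF F\<^sub>1] subset_refl])
  with cut_subset[of H] show ?thesis by (metis subset_antisym)
qed

lemma m_le: "G \<in> \<M> \<Longrightarrow> A \<subseteq> G \<Longrightarrow> m A \<le> f G"
  unfolding m_def using finite_cut by (intro Min_le) auto

lemma m_attained:
  assumes "A \<subseteq> M"
  obtains G where "G \<in> \<M>" "A \<subseteq> G" "m A = f G"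
proof -
  have "m A \<in> f ` {G \<in> \<M>. A \<subseteq> G}"
    unfolding m_def using finite_cut M_in_cut assms by (intro Min_in) auto
  then show ?thesis using that by blast
qed

text \<open>The flat hull of \<open>B\<close> belongs to the cut because \<open>B\<close> contains a
  member. So upper bounds for \<open>m\<close> may use unions of members, which need not be
  flats.\<close>

lemma m_le_rank:
  assumes "G \<in> \<M>" "G \<subseteq> B" "A \<subseteq> B" "B \<subseteq> M"
  shows "m A \<le> f B"
proof -
  obtain H where "H \<in> \<M>" "B \<subseteq> H" "f H = f B" using cut_hull[OF assms(1,2,4)] .
  then show ?thesis using m_le[of H A] assms by auto
qed

lemma rank_le_m:
  assumes "A \<subseteq> M"
  shows "f A \<le> m A"
proof -
  from assms obtain G where "G \<in> \<M>" "A \<subseteq> G" "m A = f G" by (rule m_attained)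
  then show ?thesis using mono[of A G] cut_subset by simp
qed

lemma m_eq_rank: "G \<in> \<M> \<Longrightarrow> G \<subseteq> A \<Longrightarrow> A \<subseteq> M \<Longrightarrow> m A = f A"
  by (meson antisym m_le_rank rank_le_m subset_refl)

lemma m_mono:
  assumes "A \<subseteq> B" "B \<subseteq> M"
  shows "m A \<le> m B"
proof -
  from assms(2) obtain G where "G \<in> \<M>" "B \<subseteq> G" "m B = f G" by (rule m_attained)
  then show ?thesis using m_le[of G A] assms(1) by simp
qed

lemma m_bounds: "A \<subseteq> M \<Longrightarrow> 0 \<le> m A \<and> m A \<le> f M"
  using m_le[OF M_in_cut, of A] rank_le_m[of A] f_nonneg[of A] by linarith

text \<open>If \<open>G\<close> attains \<open>m A\<close>, then \<open>G \<union> B\<close> bounds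
  \<open>m B\<close>, and submodularity for \<open>G\<close> and \<open>B\<close> compares the two
  gains. This is the source of the diminishing gains needed for adjoining points.\<close>

lemma m_minus_rank_antitone:
  assumes "A \<subseteq> B" "B \<subseteq> M"
  shows "m B - f B \<le> m A - f A"
proof -
  have "A \<subseteq> M" using assms by blast
  then obtain G where G: "G \<in> \<M>" "A \<subseteq> G" "m A = f G" by (rule m_attained)
  have GM: "G \<subseteq> M" using G cut_subset by blast
  have "m B \<le> f (G \<union> B)" using m_le_rank[OF G(1)] GM assms by auto
  moreover have "f A \<le> f (G \<inter> B)" using mono[of A "G \<inter> B"] G assms by auto
  moreover have "f (G \<inter> B) + f (G \<union> B) \<le> f G + f B" using submodular[OF GM assms(2)] .
  ultimately show ?thesis using G(3) by simp
qed

lemma not_subset_rank_less: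
  assumes "G \<in> \<M>" "H \<subseteq> M" "\<not> H \<subseteq> G"
  shows "f G < f (G \<union> H)"
proof -
  have "G \<subset> G \<union> H" "G \<union> H \<subseteq> M" using assms cut_subset by auto
  then show ?thesis using cut_flat[OF assms(1)] unfolding flat_def by blast
qed

lemma d_le: "G \<in> \<M> \<Longrightarrow> H \<in> \<M> \<Longrightarrow> G \<inter> H \<notin> \<M> \<Longrightarrow> f (G \<inter> H) + f (G \<union> H) + d \<le> f G + f H"
  using minimal[of G H] unfolding d_def modular_defect_def by simp

lemma d_eq: "d = f F\<^sub>1 + f F\<^sub>2 - f (F\<^sub>1 \<inter> F\<^sub>2) - f (F\<^sub>1 \<union> F\<^sub>2)"
  by (simp add: d_def modular_defect_def)

lemma d_pos: "0 < d"
proof -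
  have "d \<noteq> 0"
    using cut F\<^sub>1 F\<^sub>2 Int_notin unfolding modular_cut_def modular_pair_def d_def by blast
  moreover have "0 \<le> d"
    using submodular[OF cut_subset cut_subset, OF F\<^sub>1 F\<^sub>2] by (simp add: d_eq)
  ultimately show ?thesis by simp
qed

text \<open>A member of the cut of rank at most \<open>f (F\<^sub>1 \<inter> F\<^sub>2) + d\<close> above \<open>F\<^sub>1 \<inter> F\<^sub>2\<close> would, by minimality of
  \<open>d\<close>, intersect \<open>F\<^sub>1\<close> and then \<open>F\<^sub>2\<close> inside the cut, putting \<open>F\<^sub>1 \<inter> F\<^sub>2\<close> itself into the cut.\<close>

lemma m_Int_gt: "f (F\<^sub>1 \<inter> F\<^sub>2) + d < m (F\<^sub>1 \<inter> F\<^sub>2)"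
proof (rule ccontr)
  let ?K = "F\<^sub>1 \<inter> F\<^sub>2"
  assume "\<not> ?thesis"
  moreover have "?K \<subseteq> M" using cut_subset[OF F\<^sub>1] by blast
  then obtain G where G: "G \<in> \<M>" "?K \<subseteq> G" "m ?K = f G" by (rule m_attained)
  ultimately have rG: "f G \<le> f ?K + d" by simp
  have step: "G \<inter> H \<in> \<M>"
    if G: "G \<in> \<M>" "?K \<subseteq> G" "f G \<le> f ?K + d" and H: "H \<in> \<M>" "?K \<subseteq> H" for G H
  proof (rule ccontr)
    assume n: "G \<inter> H \<notin> \<M>"
    have "f ?K \<le> f (G \<inter> H)" using mono[of ?K "G \<inter> H"] G H cut_subset by blast
    then have "f (H \<union> G) \<le> f H"
      using d_le[OF G(1) H(1) n] G(3) by (simp add: Un_commute)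
    then have "G \<subseteq> H" using not_subset_rank_less[OF H(1), of G] cut_subset G by fastforce
    then show False using n G(1) by (simp add: Int_absorb2)
  qed
  have 1: "G \<inter> F\<^sub>1 \<in> \<M>" using step[OF G(1,2) rG F\<^sub>1] by blast
  have "f (G \<inter> F\<^sub>1) \<le> f G" using mono[of "G \<inter> F\<^sub>1" G] cut_subset[OF G(1)] by blast
  then have "G \<inter> F\<^sub>1 \<inter> F\<^sub>2 \<in> \<M>" using step[OF 1 _ _ F\<^sub>2] G(2) rG by auto
  moreover have "G \<inter> F\<^sub>1 \<inter> F\<^sub>2 = ?K" using G(2) by blast
  ultimately show False using Int_notin by simp
qed

section \<open>Rank functions truncated by the cut\<close>

text \<open>The right-hand side of submodularity is one of four sums, according to the term
  attaining each minimum; each sum is bounded separately. With the identity for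
  \<open>\<phi>\<close>, \<open>bad\<close> is the minimality of \<open>d\<close> and forces
  \<open>c \<le> d\<close>; a general \<open>\<phi>\<close> makes room for
  \<open>c > d\<close>.\<close>

lemma rank_like_min_cut:
  fixes \<phi> :: "real \<Rightarrow> real" and c :: real
  assumes c: "0 \<le> c"
    and incr: "\<And>x y. 0 \<le> x \<Longrightarrow> x \<le> y \<Longrightarrow> y \<le> f M \<Longrightarrow> \<phi> x \<le> \<phi> y"
    and slope: "\<And>x y. 0 \<le> x \<Longrightarrow> x \<le> y \<Longrightarrow> y \<le> f M \<Longrightarrow> \<phi> y - \<phi> x \<le> y - x"
    and exchange: "\<And>x y z w. 0 \<le> z \<Longrightarrow> z \<le> x \<Longrightarrow> x \<le> w \<Longrightarrow> y \<le> w \<Longrightarrow> w \<le> f M \<Longrightarrow> z + w \<le> x + y \<Longrightarrow>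
      \<phi> z + \<phi> w \<le> \<phi> x + \<phi> y"
    and bad: "\<And>G H. G \<in> \<M> \<Longrightarrow> H \<in> \<M> \<Longrightarrow> G \<inter> H \<notin> \<M> \<Longrightarrow>
      f (G \<inter> H) + c + \<phi> (f (G \<union> H)) \<le> \<phi> (f G) + \<phi> (f H)"
  shows "rank_like (\<lambda>A. min (f A + c) (\<phi> (m A))) M"
proof (rule rank_likeI)
  fix A B assume AB: "A \<subseteq> B" "B \<subseteq> M"
  have "\<phi> (m A) \<le> \<phi> (m B)" using m_mono[OF AB] m_bounds[of A] m_bounds[of B] AB by (intro incr) auto
  then show "min (f A + c) (\<phi> (m A)) \<le> min (f B + c) (\<phi> (m B))"
    using mono[OF AB] by linarith
next
  let ?w = "\<lambda>A. min (f A + c) (\<phi> (m A))"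
  have \<phi>m: "\<phi> (m A) \<le> \<phi> (f B)" if "G \<in> \<M>" "G \<subseteq> B" "A \<subseteq> B" "B \<subseteq> M" for A B G
    using incr m_le_rank[OF that] m_bounds[of A] that mono[of B M] by auto
  \<comment> \<open>The intersection is bounded by its \<open>f\<close> term and the union by its
    cut term; \<open>slope\<close> carries the submodularity of \<open>f\<close> through
    \<open>\<phi>\<close>.\<close>
  have mixed: "?w (A \<inter> B) + ?w (A \<union> B) \<le> f A + c + \<phi> (m B)" if A: "A \<subseteq> M" and B: "B \<subseteq> M" for A B
  proof -
    obtain G where G: "G \<in> \<M>" "B \<subseteq> G" "m B = f G" using B by (rule m_attained)
    have GM: "G \<subseteq> M" using G cut_subset by blast
    have "f (A \<inter> G) + f (A \<union> G) \<le> f A + f G" using submodular[OF A GM] .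
    moreover have "f (A \<inter> B) \<le> f (A \<inter> G)" using mono[of "A \<inter> B" "A \<inter> G"] G A by blast
    moreover have "\<phi> (f (A \<union> G)) - \<phi> (f G) \<le> f (A \<union> G) - f G"
      using slope[of "f G" "f (A \<union> G)"] f_nonneg[OF GM] mono[of G "A \<union> G"] mono[of "A \<union> G" M] A GM by auto
    moreover have "\<phi> (m (A \<union> B)) \<le> \<phi> (f (A \<union> G))"
      using \<phi>m[OF G(1), of "A \<union> G" "A \<union> B"] G A GM by auto
    ultimately show ?thesis unfolding G(3) by linarith
  qed
  fix A B assume A: "A \<subseteq> M" and B: "B \<subseteq> M"
  have "?w (A \<inter> B) + ?w (A \<union> B) \<le> (f A + c) + (f B + c)"
    using submodular[OF A B] c by linarith
  moreover have "?w (A \<inter> B) + ?w (A \<union> B) \<le> f A + c + \<phi> (m B)"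
    using mixed[OF A B] .
  moreover have "?w (A \<inter> B) + ?w (A \<union> B) \<le> \<phi> (m A) + (f B + c)"
    using mixed[OF B A] by (simp add: Int_commute Un_commute add.commute)
  moreover have "?w (A \<inter> B) + ?w (A \<union> B) \<le> \<phi> (m A) + \<phi> (m B)"
  proof -
    obtain G where G: "G \<in> \<M>" "A \<subseteq> G" "m A = f G" using A by (rule m_attained)
    obtain H where H: "H \<in> \<M>" "B \<subseteq> H" "m B = f H" using B by (rule m_attained)
    have GM: "G \<subseteq> M" and HM: "H \<subseteq> M" using G H cut_subset by auto
    have un: "\<phi> (m (A \<union> B)) \<le> \<phi> (f (G \<union> H))"
      using \<phi>m[OF G(1), of "G \<union> H" "A \<union> B"] G H GM HM by auto
    show ?thesis
    \<comment> \<open>Inside the cut, \<open>G \<inter> H\<close> bounds the cut term of the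
      intersection; outside, the \<open>f\<close> term is used and \<open>bad\<close> pays for
      \<open>c\<close>.\<close>
    proof (cases "G \<inter> H \<in> \<M>")
      case True
      have "\<phi> (m (A \<inter> B)) \<le> \<phi> (f (G \<inter> H))"
        using \<phi>m[OF True, of "G \<inter> H" "A \<inter> B"] G H GM by auto
      moreover have "\<phi> (f (G \<inter> H)) + \<phi> (f (G \<union> H)) \<le> \<phi> (f G) + \<phi> (f H)"
        using submodular[OF GM HM] mono[of "G \<inter> H" G] mono[of G "G \<union> H"] mono[of H "G \<union> H"]
          mono[of "G \<union> H" M] f_nonneg[of "G \<inter> H"] GM HM by (intro exchange) auto
      ultimately show ?thesis using un unfolding G(3) H(3) by linarith
    next
      case False
      have "f (A \<inter> B) \<le> f (G \<inter> H)" using mono[of "A \<inter> B" "G \<inter> H"] G H GM by auto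
      with bad[OF G(1) H(1) False] un show ?thesis unfolding G(3) H(3) by linarith
    qed
  qed
  ultimately show "?w (A \<inter> B) + ?w (A \<union> B) \<le> ?w A + ?w B"
    by linarith
qed

lemma rank_like_min_cut_id:
  assumes "0 \<le> c" "c \<le> d"
  shows "rank_like (\<lambda>A. min (f A + c) (m A)) M"
proof -
  have "f (G \<inter> H) + c + f (G \<union> H) \<le> f G + f H" if "G \<in> \<M>" "H \<in> \<M>" "G \<inter> H \<notin> \<M>" for G H
    using d_le[OF that] assms(2) by simp
  then show ?thesis using rank_like_min_cut[of c "\<lambda>x. x"] assms(1) by simp
qed

lemma min_cut_minus_rank_antitone:
  assumes "A \<subseteq> B" "B \<subseteq> M"
  shows "min (f B + c) (m B) - f B \<le> min (f A + c) (m A) - f A"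
  using m_minus_rank_antitone[OF assms] by linarith

text \<open>The function \<open>\<phi> x = x - \<kappa> exp (\<Lambda> x)\<close> with large \<open>\<Lambda>\<close> and tiny \<open>\<kappa>\<close> drops so much faster at
  \<open>f (G \<union> H)\<close> than at \<open>f G\<close> and \<open>f H\<close> that it increases the defect of all pairs \<open>G, H\<close> with
  \<open>G \<inter> H\<close> outside the cut.\<close>

lemma defect_increasing_function:
  obtains \<phi> :: "real \<Rightarrow> real" and \<kappa> r :: real
  where "0 < \<kappa>" "\<kappa> \<le> d" "0 \<le> r"
    and "\<And>x. \<phi> x \<le> x" "\<And>x. x \<le> f M \<Longrightarrow> x - r \<le> \<phi> x"
    and "\<And>x y. x \<le> y \<Longrightarrow> \<phi> y - \<phi> x \<le> y - x"
    and "rank_like (\<lambda>A. min (f A + (d + \<kappa>)) (\<phi> (m A))) M"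
    and "f (F\<^sub>1 \<inter> F\<^sub>2) + (d + \<kappa>) \<le> \<phi> (m (F\<^sub>1 \<inter> F\<^sub>2))"
proof -
  obtain \<gamma> where \<gamma>: "\<gamma> > 0" and
    gap: "\<And>A B. A \<in> Pow M \<Longrightarrow> B \<in> Pow M \<Longrightarrow> f A < f B \<Longrightarrow> f A + \<gamma> \<le> f B"
    using finite_image_gap[of "Pow M" f] finite_M by auto
  \<comment> \<open>A strict increase of rank is at least \<open>\<gamma>\<close>, so it multiplies
    \<open>exp (\<Lambda> * f A)\<close> by at least \<open>exp 2 \<ge> 3\<close>.\<close>
  define \<Lambda> where "\<Lambda> = 2 / \<gamma>"
  define E where "E = exp (\<Lambda> * f M)"
  define s where "s = m (F\<^sub>1 \<inter> F\<^sub>2) - f (F\<^sub>1 \<inter> F\<^sub>2) - d"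
  \<comment> \<open>The three bounds serve, in order, \<open>\<kappa> \<le> d\<close>, the final
    inequality at \<open>F\<^sub>1 \<inter> F\<^sub>2\<close>, where \<open>s\<close> is the
    available slack, and the smallness condition of \<open>exp_exchange\<close>.\<close>
  define \<kappa> where "\<kappa> = Min {d, s / (1 + E), 1 / (\<Lambda> * E)}"
  define \<phi> where "\<phi> x = x - \<kappa> * exp (\<Lambda> * x)" for x
  have \<Lambda>: "\<Lambda> > 0" using \<gamma> by (simp add: \<Lambda>_def)
  have E: "E > 0" by (simp add: E_def)
  have s: "s > 0" using m_Int_gt by (simp add: s_def)
  have \<kappa>: "0 < \<kappa>" "\<kappa> \<le> d" using d_pos s \<Lambda> E by (auto simp: \<kappa>_def add_pos_pos)
  have "\<kappa> \<le> s / (1 + E)" by (simp add: \<kappa>_def)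
  then have \<kappa>s: "\<kappa> + \<kappa> * E \<le> s" using E by (simp add: field_simps)
  have "\<kappa> \<le> 1 / (\<Lambda> * E)" by (simp add: \<kappa>_def)
  then have \<kappa>\<Lambda>: "\<kappa> * \<Lambda> * E \<le> 1" using E \<Lambda> by (simp add: field_simps)
  have exp_le: "\<kappa> * exp (\<Lambda> * x) \<le> \<kappa> * E" if "x \<le> f M" for x
    using \<kappa> \<Lambda> that by (simp add: E_def)
  have exch: "\<phi> z + \<phi> w \<le> \<phi> x + \<phi> y"
    if "z \<le> x" "x \<le> w" "y \<le> w" "w \<le> f M" "z + w \<le> x + y" for x y z w
  proof -
    have "\<kappa> * \<Lambda> * exp (\<Lambda> * w) \<le> \<kappa> * \<Lambda> * E"
      using \<kappa> \<Lambda> that by (simp add: E_def)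
    with \<kappa>\<Lambda> have "\<kappa> * \<Lambda> * exp (\<Lambda> * w) \<le> 1" by (rule order_trans[rotated])
    then show ?thesis unfolding \<phi>_def
      using exp_exchange[OF that(1-3,5), of \<Lambda> \<kappa>] \<kappa> \<Lambda> by simp
  qed
  have slope: "\<phi> y - \<phi> x \<le> y - x" if "x \<le> y" for x y
    using \<kappa> \<Lambda> that by (simp add: \<phi>_def)
  have bad: "f (G \<inter> H) + (d + \<kappa>) + \<phi> (f (G \<union> H)) \<le> \<phi> (f G) + \<phi> (f H)"
    if GH: "G \<in> \<M>" "H \<in> \<M>" "G \<inter> H \<notin> \<M>" for G H
  proof -
    let ?e = "\<lambda>A. exp (\<Lambda> * f A)"
    have GM: "G \<subseteq> M" and HM: "H \<subseteq> M" using GH cut_subset by auto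
    have triple: "3 * ?e A \<le> ?e (A \<union> B)"
      if "A \<in> \<M>" "B \<subseteq> M" "\<not> B \<subseteq> A" for A B
    proof -
      have "f A + \<gamma> \<le> f (A \<union> B)"
        using gap[OF _ _ not_subset_rank_less[OF that]] that cut_subset by auto
      then have "\<Lambda> * (f A + \<gamma>) \<le> \<Lambda> * f (A \<union> B)" using \<Lambda> by simp
      then have "2 + \<Lambda> * f A \<le> \<Lambda> * f (A \<union> B)" using \<gamma> by (simp add: \<Lambda>_def field_simps)
      then have "exp 2 * ?e A \<le> ?e (A \<union> B)" by (simp add: exp_add[symmetric])
      moreover have "3 * ?e A \<le> exp 2 * ?e A"
        using exp_ge_add_one_self[of "2::real"] by (intro mult_right_mono) auto
      ultimately show ?thesis by linarith
    qed
    have "\<not> H \<subseteq> G" "\<not> G \<subseteq> H" using GH by (auto simp: Int_absorb1 Int_absorb2)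
    then have "3 * ?e G \<le> ?e (G \<union> H)" "3 * ?e H \<le> ?e (G \<union> H)"
      using triple[of G H] triple[of H G] GH GM HM by (auto simp: Un_commute)
    moreover have "1 \<le> ?e G" "1 \<le> ?e H" using \<Lambda> f_nonneg GM HM by auto
    \<comment> \<open>The summand \<open>1\<close>, multiplied by \<open>\<kappa>\<close>, pays for
      raising the constant from \<open>d\<close> to \<open>d + \<kappa>\<close>.\<close>
    ultimately have "1 + ?e G + ?e H \<le> ?e (G \<union> H)" by linarith
    then have "\<kappa> * (1 + ?e G + ?e H) \<le> \<kappa> * ?e (G \<union> H)" using \<kappa> by simp
    with d_le[OF GH] show ?thesis by (simp add: \<phi>_def algebra_simps)
  qed
  show ?thesis
  proof (rule that[of \<kappa> "\<kappa> * E" \<phi>])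
    show "rank_like (\<lambda>A. min (f A + (d + \<kappa>)) (\<phi> (m A))) M"
    proof (rule rank_like_min_cut)
      \<comment> \<open>Monotonicity is the degenerate exchange of \<open>x, y\<close> for
        \<open>y, y\<close>.\<close>
      show "\<phi> x \<le> \<phi> y" if "x \<le> y" "y \<le> f M" for x y
        using exch[where x = y and y = y and z = x and w = y] that by simp
    qed (use \<kappa> d_pos slope exch bad in auto)
    show "f (F\<^sub>1 \<inter> F\<^sub>2) + (d + \<kappa>) \<le> \<phi> (m (F\<^sub>1 \<inter> F\<^sub>2))"
    proof -
      have "F\<^sub>1 \<inter> F\<^sub>2 \<subseteq> M" using cut_subset[OF F\<^sub>1] by blast
      then show ?thesis
        using \<kappa>s exp_le[of "m (F\<^sub>1 \<inter> F\<^sub>2)"] m_bounds[of "F\<^sub>1 \<inter> F\<^sub>2"] by (simp add: \<phi>_def s_def)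
    qed
  qed (use \<kappa> E exp_le slope in \<open>auto simp: \<phi>_def\<close>)
qed

subsection \<open>Two extensions without an amalgam\<close>

text \<open>The truncation by \<open>m\<close> makes \<open>e\<close> add nothing to a member of the
  cut, while by \<open>m_Int_gt\<close> it adds its full weight \<open>d\<close> to
  \<open>F\<^sub>1 \<inter> F\<^sub>2\<close>.\<close>

lemma common_point_extension:
  assumes "e \<notin> M"
  obtains g where "extension g (insert e M) f M"
    "g (insert e F\<^sub>1) = f F\<^sub>1" "g (insert e F\<^sub>2) = f F\<^sub>2"
    "g (insert e (F\<^sub>1 \<inter> F\<^sub>2)) = f (F\<^sub>1 \<inter> F\<^sub>2) + d"
proof -
  let ?b = "\<lambda>A. min (f A + d) (m A)"
  let ?g = "adjoin e f ?b"
  have "rank_like ?g (insert e M)"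
    using d_pos rank_le_m min_cut_minus_rank_antitone assms
    by (intro rank_like_adjoin rank_like rank_like_min_cut_id) auto
  moreover have "?g A = f A" if "A \<subseteq> M" for A
    using that assms by (intro adjoin_notin) auto
  ultimately have "extension ?g (insert e M) f M"
    using finite_M f_empty by (simp add: extension_def polymatroid_iff_rank_like subset_insertI)
  moreover have "e \<notin> F\<^sub>1" "e \<notin> F\<^sub>2" using assms cut_subset F\<^sub>1 F\<^sub>2 by auto
  moreover have "m F\<^sub>1 = f F\<^sub>1" "m F\<^sub>2 = f F\<^sub>2" using m_eq_rank cut_subset F\<^sub>1 F\<^sub>2 by auto
  ultimately show ?thesis using that[of ?g] d_pos m_Int_gt by simp
qed

text \<open>Here \<open>u\<close> is the rank of a set together with one of \<open>x\<close>, \<open>y\<close>, and \<open>v\<close> its rank together with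
  both. The slack \<open>r\<close> of the free parts is only needed for \<open>u \<le> v\<close>.\<close>

lemma ingleton_violating_extension:
  assumes "x \<notin> M" "y \<notin> M" "x \<noteq> y"
  obtains g t where "extension g (insert y (insert x M)) f M"
    and "\<And>z. z \<in> {x, y} \<Longrightarrow> g (insert z F\<^sub>1) + g (insert z F\<^sub>2) - g (insert z (F\<^sub>1 \<union> F\<^sub>2)) = t"
    and "2 * t < f (F\<^sub>1 \<inter> F\<^sub>2) + d + g (insert y (insert x (F\<^sub>1 \<inter> F\<^sub>2)))"
proof -
  obtain \<phi> :: "real \<Rightarrow> real" and \<kappa> r :: real
    where \<kappa>: "0 < \<kappa>" "\<kappa> \<le> d" and r: "0 \<le> r"
      and \<phi>_le: "\<And>x. \<phi> x \<le> x" and \<phi>_ge: "\<And>x. x \<le> f M \<Longrightarrow> x - r \<le> \<phi> x"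
      and slope: "\<And>x y. x \<le> y \<Longrightarrow> \<phi> y - \<phi> x \<le> y - x"
      and rl: "rank_like (\<lambda>A. min (f A + (d + \<kappa>)) (\<phi> (m A))) M"
      and K: "f (F\<^sub>1 \<inter> F\<^sub>2) + (d + \<kappa>) \<le> \<phi> (m (F\<^sub>1 \<inter> F\<^sub>2))"
    by (rule defect_increasing_function) (rule that)
  \<comment> \<open>The bound \<open>\<theta> \<le> d\<close> makes \<open>u\<close> submodular,
    whereas \<open>2 * \<theta>\<close> exceeds \<open>d\<close> and needs the modified
    \<open>\<phi>\<close> in \<open>v\<close>.\<close>
  define \<theta> where "\<theta> = (d + \<kappa>) / 2"
  have \<theta>: "0 \<le> \<theta>" "\<theta> \<le> d" using \<kappa> d_pos by (auto simp: \<theta>_def)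
  define u where "u A = min (f A + \<theta>) (m A) + r" for A
  define v where "v A = min (f A + (d + \<kappa>)) (\<phi> (m A)) + 2 * r" for A
  have dk: "d + \<kappa> = 2 * \<theta>" by (simp add: \<theta>_def)
  have rl_u: "rank_like u M" unfolding u_def
    by (intro rank_like_add_const rank_like_min_cut_id \<theta>)
  have rl_v: "rank_like v M" unfolding v_def
    by (intro rank_like_add_const rl)
  have fu: "f A \<le> u A" if "A \<subseteq> M" for A
    using rank_le_m[OF that] \<theta> r by (simp add: u_def)
  have uv: "u A \<le> v A" if "A \<subseteq> M" for A
    using \<phi>_ge[of "m A"] m_bounds[OF that] \<theta> r unfolding u_def v_def dk by linarith
  have anti_u: "u B - f B \<le> u A - f A" if "A \<subseteq> B" "B \<subseteq> M" for A B
    using min_cut_minus_rank_antitone[OF that, of \<theta>] by (simp add: u_def)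
  have anti_v: "v B - u B \<le> v A - u A" if "A \<subseteq> B" "B \<subseteq> M" for A B
  proof -
    \<comment> \<open>In this form every ingredient is visibly antitone:
      \<open>\<phi> (m A) - m A\<close> by \<open>slope\<close>, and \<open>m A - f A\<close> as
      shown before.\<close>
    have eq: "v A - u A = min \<theta> (\<phi> (m A) - m A + max (m A - f A - \<theta>) 0) + r" for A
      using \<phi>_le[of "m A"] \<theta> unfolding u_def v_def dk by linarith
    show ?thesis
      using slope[OF m_mono[OF that]] m_minus_rank_antitone[OF that] unfolding eq by linarith
  qed
  \<comment> \<open>The second point gains at most as much as the first. This settles the
    diminishing gain of \<open>y\<close> when the larger set contains \<open>x\<close> and the
    smaller does not.\<close>
  have conc: "v A - u A \<le> u A - f A" if "A \<subseteq> M" for A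
    using rank_le_m[OF that] \<phi>_le[of "m A"] unfolding u_def v_def dk by linarith
  \<comment> \<open>\<open>?a\<close> ranks sets without \<open>y\<close> and \<open>?b\<close>
    ranks them joined with \<open>y\<close>; the result is symmetric in \<open>x\<close> and
    \<open>y\<close>.\<close>
  let ?a = "adjoin x f u" and ?b = "adjoin x u v"
  have rl_g: "rank_like (adjoin y ?a ?b) (insert y (insert x M))"
  proof (rule rank_like_adjoin)
    show "rank_like ?a (insert x M)" "rank_like ?b (insert x M)"
      using assms fu uv anti_u anti_v by (auto intro!: rank_like_adjoin rank_like rl_u rl_v)
    show "?a A \<le> ?b A" if "A \<subseteq> insert x M" for A
      using that assms(1) fu uv by (cases rule: subset_insert_cases) auto
    show "?b B - ?a B \<le> ?b A - ?a A" if AB: "A \<subseteq> B" and B: "B \<subseteq> insert x M" for A B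
    proof -
      have A': "A - {x} \<subseteq> B - {x}" and B': "B - {x} \<subseteq> M" using AB B by auto
      show ?thesis
        using anti_u[OF A' B'] anti_v[OF A' B'] conc[OF B'] conc[of "A - {x}"] A' B' AB
        by (auto simp: adjoin_def)
    qed
    show "y \<notin> insert x M" using assms by auto
  qed
  have f_ext: "adjoin y ?a ?b A = f A" if "A \<subseteq> M" for A
  proof -
    have "x \<notin> A" "y \<notin> A" using that assms by auto
    then show ?thesis by simp
  qed
  have "M \<subseteq> insert y (insert x M)" by blast
  with rl_g have ext: "extension (adjoin y ?a ?b) (insert y (insert x M)) f M"
    using finite_M f_empty f_ext by (simp add: extension_def polymatroid_iff_rank_like)
  have sub: "F\<^sub>1 \<subseteq> M" "F\<^sub>2 \<subseteq> M" using F\<^sub>1 F\<^sub>2 cut_subset by auto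
  then have nin: "x \<notin> F\<^sub>1" "x \<notin> F\<^sub>2" "y \<notin> F\<^sub>1" "y \<notin> F\<^sub>2" using assms by auto
  have val: "adjoin y ?a ?b (insert z A) = u A" if "z \<in> {x, y}" "A \<subseteq> M" for z A
  proof -
    have "x \<notin> A" "y \<notin> A" using that assms by auto
    then show ?thesis using that assms(3) by auto
  qed
  have uF: "u A = f A + r" if "G \<in> \<M>" "G \<subseteq> A" "A \<subseteq> M" for A G
    using m_eq_rank[OF that] \<theta> by (simp add: u_def)
  have "u F\<^sub>1 = f F\<^sub>1 + r" "u F\<^sub>2 = f F\<^sub>2 + r" "u (F\<^sub>1 \<union> F\<^sub>2) = f (F\<^sub>1 \<union> F\<^sub>2) + r"
    using uF F\<^sub>1 F\<^sub>2 sub by auto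
  moreover have "v (F\<^sub>1 \<inter> F\<^sub>2) = f (F\<^sub>1 \<inter> F\<^sub>2) + d + \<kappa> + 2 * r"
    using K by (simp add: v_def)
  moreover have "x \<notin> F\<^sub>1 \<inter> F\<^sub>2" "y \<notin> insert x (F\<^sub>1 \<inter> F\<^sub>2)" using nin assms(3) by auto
  then have "adjoin y ?a ?b (insert y (insert x (F\<^sub>1 \<inter> F\<^sub>2))) = v (F\<^sub>1 \<inter> F\<^sub>2)"
    by simp
  \<comment> \<open>By \<open>d_eq\<close> the given value of \<open>t\<close> is exact, and the
    strict inequality holds with margin \<open>\<kappa>\<close>.\<close>
  ultimately show ?thesis
    using that[OF ext, of "f (F\<^sub>1 \<inter> F\<^sub>2) + d + r"] val sub \<kappa> by (simp add: d_eq)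
qed

text \<open>In an amalgam, \<open>e\<close> would be a common point of \<open>F\<^sub>1\<close> and \<open>F\<^sub>2\<close>, so that Ingleton's inequality would have to
  hold for \<open>F\<^sub>1\<close>, \<open>F\<^sub>2\<close>, \<open>x\<close>, \<open>y\<close> over \<open>F\<^sub>1 \<inter> F\<^sub>2\<close>.\<close>

lemma not_amalgamable:
  assumes "e \<notin> M" "x \<notin> M" "y \<notin> M" "e \<noteq> x" "e \<noteq> y" "x \<noteq> y"
  obtains g\<^sub>1 g\<^sub>2 where "extension g\<^sub>1 (insert e M) f M" "extension g\<^sub>2 (insert y (insert x M)) f M"
    "\<And>h. \<not> amalgam h g\<^sub>1 (insert e M) g\<^sub>2 (insert y (insert x M))"
proof -
  let ?K = "F\<^sub>1 \<inter> F\<^sub>2" and ?U = "F\<^sub>1 \<union> F\<^sub>2"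
  obtain g\<^sub>1 where g\<^sub>1: "extension g\<^sub>1 (insert e M) f M"
    "g\<^sub>1 (insert e F\<^sub>1) = f F\<^sub>1" "g\<^sub>1 (insert e F\<^sub>2) = f F\<^sub>2" "g\<^sub>1 (insert e ?K) = f ?K + d"
    using common_point_extension[OF assms(1)] .
  obtain g\<^sub>2 t where g\<^sub>2: "extension g\<^sub>2 (insert y (insert x M)) f M"
    and t: "\<And>z. z \<in> {x, y} \<Longrightarrow> g\<^sub>2 (insert z F\<^sub>1) + g\<^sub>2 (insert z F\<^sub>2) - g\<^sub>2 (insert z ?U) = t"
      "2 * t < f ?K + d + g\<^sub>2 (insert y (insert x ?K))"
    using assms(2,3,6) by (rule ingleton_violating_extension) (rule that)
  have "\<not> amalgam h g\<^sub>1 (insert e M) g\<^sub>2 (insert y (insert x M))" for h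
  proof
    assume "amalgam h g\<^sub>1 (insert e M) g\<^sub>2 (insert y (insert x M))"
    then have h: "polymatroid h (insert e M \<union> insert y (insert x M))"
      and h1: "\<And>A. A \<subseteq> insert e M \<Longrightarrow> h A = g\<^sub>1 A"
      and h2: "\<And>A. A \<subseteq> insert y (insert x M) \<Longrightarrow> h A = g\<^sub>2 A"
      by (auto simp: amalgam_def extension_def)
    have hf: "h A = f A" if "A \<subseteq> M" for A
      using h1[of A] g\<^sub>1(1) that by (auto simp: extension_def)
    define N where "N = insert e M \<union> insert y (insert x M)"
    have rl: "rank_like h N" using h by (simp add: N_def polymatroid_iff_rank_like)
    have sub: "F\<^sub>1 \<subseteq> M" "F\<^sub>2 \<subseteq> M" using F\<^sub>1 F\<^sub>2 cut_subset by auto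
    then have nin: "e \<notin> F\<^sub>1" "e \<notin> F\<^sub>2" "x \<notin> F\<^sub>1" "x \<notin> F\<^sub>2" "y \<notin> F\<^sub>1" "y \<notin> F\<^sub>2"
      using assms by auto
    have inN: "insert e (insert y (insert x A)) \<subseteq> N" if "A \<subseteq> M" for A
      using that by (auto simp: N_def)
    \<comment> \<open>Adding \<open>e\<close> to \<open>F\<^sub>1\<close> or
      \<open>F\<^sub>2\<close> costs no rank, even in the presence of \<open>z\<close>.
      Submodularity for these two sets joined with \<open>e\<close> and \<open>z\<close> then bounds
      their intersection.\<close>
    have K: "h (insert z (insert e ?K)) \<le> t" if z: "z \<in> {x, y}" for z
    proof -
      have add_e: "h (insert z (insert e F)) \<le> h (insert z F)"
        if F: "F \<in> {F\<^sub>1, F\<^sub>2}" for F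
      proof -
        have "F \<subseteq> M" "insert e F \<subseteq> insert e M" using F sub by auto
        then have "h (insert e F) = h F"
          using F h1[of "insert e F"] hf[of F] g\<^sub>1(2,3) by auto
        moreover have "insert e F \<inter> insert z F = F"
          using F z nin assms by auto
        moreover have "insert e F \<union> insert z F = insert z (insert e F)"
          by auto
        moreover have "insert e F \<subseteq> N" "insert z F \<subseteq> N"
          using F z inN[of F] sub by auto
        ultimately show ?thesis
          using rank_like_submodular[OF rl, of "insert e F" "insert z F"] by simp
      qed
      let ?F = "\<lambda>F. insert z (insert e F)"
      have FN: "?F F\<^sub>1 \<subseteq> N" "?F F\<^sub>2 \<subseteq> N"
        using z inN[of F\<^sub>1] inN[of F\<^sub>2] sub by auto
      have "?F F\<^sub>1 \<inter> ?F F\<^sub>2 = ?F ?K" "?F F\<^sub>1 \<union> ?F F\<^sub>2 = ?F ?U" by auto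
      then have "h (?F ?K) + h (?F ?U) \<le> h (?F F\<^sub>1) + h (?F F\<^sub>2)"
        using rank_like_submodular[OF rl FN] by simp
      moreover have "h (insert z ?U) \<le> h (?F ?U)"
        using FN by (intro rank_like_mono[OF rl]) auto
      moreover have h2z: "h (insert z A) = g\<^sub>2 (insert z A)" if "A \<subseteq> M" for A
        using that z by (intro h2) auto
      then have "h (insert z F\<^sub>1) + h (insert z F\<^sub>2) - h (insert z ?U) = t"
        using t(1)[OF z] h2z[of F\<^sub>1] h2z[of F\<^sub>2] h2z[of ?U] sub by simp
      ultimately show ?thesis using add_e[of F\<^sub>1] add_e[of F\<^sub>2] by simp
    qed
    have KN: "insert x (insert e ?K) \<subseteq> N" "insert y (insert e ?K) \<subseteq> N"
      using inN[of ?K] sub by auto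
    \<comment> \<open>The sets for \<open>x\<close> and \<open>y\<close> meet in
      \<open>insert e ?K\<close>, of rank \<open>f ?K + d\<close>, and their union has at least the
      rank of \<open>?K\<close> with \<open>x\<close> and \<open>y\<close>; together this
      contradicts \<open>t(2)\<close>.\<close>
    have "h (insert x (insert e ?K) \<inter> insert y (insert e ?K)) +
        h (insert x (insert e ?K) \<union> insert y (insert e ?K)) \<le> 2 * t"
      using rank_like_submodular[OF rl KN] K[of x] K[of y] by simp
    moreover have "insert x (insert e ?K) \<inter> insert y (insert e ?K) = insert e ?K"
      using nin assms by auto
    moreover have "insert x (insert e ?K) \<union> insert y (insert e ?K) = insert e (insert y (insert x ?K))"
      by auto
    moreover have "h (insert e ?K) = f ?K + d"
      using h1[of "insert e ?K"] g\<^sub>1(4) sub by auto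
    moreover have "h (insert y (insert x ?K)) \<le> h (insert e (insert y (insert x ?K)))"
      using inN[of ?K] sub by (intro rank_like_mono[OF rl]) auto
    moreover have "h (insert y (insert x ?K)) = g\<^sub>2 (insert y (insert x ?K))"
      using sub by (intro h2) auto
    ultimately show False using t(2) by simp
  qed
  then show ?thesis using that g\<^sub>1(1) g\<^sub>2 by blast
qed

end

section \<open>Existence of a critical pair and conclusion\<close>

text \<open>A nonempty finite family closed under binary intersections contains its total
  intersection, so a non-principal cut has a pair violating closure; among the finitely many such
  pairs one has least defect.\<close>

lemma critical_pair_exists:
  assumes poly: "polymatroid f M" and cut: "modular_cut f M \<M>" and np: "\<not> principal_cut \<M>"
  obtains F\<^sub>1 F\<^sub>2 where "critical_pair f M \<M> F\<^sub>1 F\<^sub>2"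
proof -
  define P where "P = {(G, H) \<in> \<M> \<times> \<M>. G \<inter> H \<notin> \<M>}"
  have "\<M> \<subseteq> Pow M" using cut unfolding modular_cut_def flat_def by blast
  then have fin: "finite \<M>" using poly by (auto simp: polymatroid_def intro: finite_subset)
  then have finP: "finite P" by (auto simp: P_def intro: finite_subset[of _ "\<M> \<times> \<M>"])
  have "P \<noteq> {}"
  proof
    assume "P = {}"
    then have "\<Inter>\<M> \<in> \<M>"
      using np by (intro finite_Inf_in[OF fin]) (auto simp: P_def principal_cut_def)
    then show False using np by (simp add: principal_cut_def)
  qed
  with finP obtain p where p: "p \<in> P"
    and min: "\<forall>q\<in>P. modular_defect f (fst p) (snd p) \<le> modular_defect f (fst q) (snd q)"
    using arg_min_if_finite[OF finP, of "\<lambda>q. modular_defect f (fst q) (snd q)"]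
    by (metis (no_types, lifting) linorder_not_less)
  have "critical_pair f M \<M> (fst p) (snd p)"
  proof
    show "modular_defect f (fst p) (snd p) \<le> modular_defect f G H"
      if "G \<in> \<M>" "H \<in> \<M>" "G \<inter> H \<notin> \<M>" for G H
      using min[THEN bspec, of "(G, H)"] that by (simp add: P_def)
  qed (use p poly cut in \<open>auto simp: P_def\<close>)
  then show ?thesis by (rule that)
qed

theorem theorem1:
  fixes f :: "'a::infinite set \<Rightarrow> real" and M :: "'a set"
  assumes "polymatroid f M"
    and "\<exists>\<M>. modular_cut f M \<M> \<and> \<not> principal_cut \<M>"
  shows "\<not> sticky f M"
proof
  assume sticky: "sticky f M"
  obtain \<M> F\<^sub>1 F\<^sub>2 where "critical_pair f M \<M> F\<^sub>1 F\<^sub>2"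
    using assms critical_pair_exists by metis
  then interpret critical_pair f M \<M> F\<^sub>1 F\<^sub>2 .
  have inf: "infinite (UNIV :: 'a set)" by (rule infinite_UNIV)
  obtain e where e: "e \<notin> M"
    using ex_new_if_finite[OF inf finite_M] by blast
  obtain x where x: "x \<notin> insert e M"
    using ex_new_if_finite[OF inf, of "insert e M"] finite_M by blast
  obtain y where y: "y \<notin> insert x (insert e M)"
    using ex_new_if_finite[OF inf, of "insert x (insert e M)"] finite_M by blast
  obtain g\<^sub>1 g\<^sub>2 where g: "extension g\<^sub>1 (insert e M) f M" "extension g\<^sub>2 (insert y (insert x M)) f M"
    and not_amalgam: "\<And>h. \<not> amalgam h g\<^sub>1 (insert e M) g\<^sub>2 (insert y (insert x M))"
    using not_amalgamable[of e x y] e x y by blast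
  have "insert e M \<inter> insert y (insert x M) = M" using e x y by auto
  then show False using sticky g not_amalgam unfolding sticky_def by blast
qed

end
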